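(* Let $\Delta$ be a pure two-dimensional simplicial complex on $n$ vertices. (i) If $I_\Delta^{(2)}=I_\Delta^2$, then $\Delta_1$ is a Ramsey $(5,3)$-graph. (ii) If $I_\Delta^{(m)}=I_\Delta^m$ for some $m\ge 3$ and $n\ge 6$, then $\Delta_1$ is a Ramsey $(4,3)$-graph.
   Context: Let $K$ be a field and $R=K[x_1,\dots,x_n]$. A simplicial complex $\Delta$ on the vertex set $[n]=\{1,\dots,n\}$ is assumed to satisfy $\{i\}\in\Delta$ for every $i\in[n]$. A facet is a maximal face; $\mathcal F(\Delta)$ is the set of facets; $\Delta$ is pure if all facets have the same dimension. The Stanley-Reisner ideal is $I_\Delta=(x_{i_1}\cdots x_{i_s} : \{i_1,\dots,i_s\}\notin\Delta)$. The $m$-th symbolic power is $I_\Delta^{(m)}=\bigcap_{F\in\mathcal F(\Delta)}P_F^m$, where $P_F=(x_i : i\notin F)$. $\Delta_1$ denotes the graph on $[n]$ whose edges are the two-element faces of $\Delta$. A Ramsey $(s,t)$-graph is a graph with no clique of size $s$ and no independent set of size $t$. *)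

theory Defs
  imports
    "HOL-Library.Cardinality"
    "HOL-Library.Poly_Mapping"
    "HOL-Library.Ramsey"
    "HOL-Algebra.Ideal_Product"
    "HOL-Algebra.Algebraic_Closure_Type"
begin

text \<open>
  The polynomial ring in one variable per element of \<open>'n\<close>: exponent vectors are finitely
  supported functions \<open>'n \<Rightarrow>\<^sub>0 nat\<close>, and the product is the convolution product of
  \<^theory>\<open>HOL-Library.Poly_Mapping\<close>. The finite type \<open>'n\<close> plays the role of
  the vertex set \<open>{1, ..., n}\<close>, so that \<open>n = CARD('n)\<close>.
\<close>

type_synonym ('n, 'k) mpoly = "('n \<Rightarrow>\<^sub>0 nat) \<Rightarrow>\<^sub>0 'k"

abbreviation mpoly_ring :: "('n, 'k::comm_ring_1) mpoly ring" where
  "mpoly_ring \<equiv> ring_of_type_algebra"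

definition var :: "'n \<Rightarrow> ('n, 'k::comm_ring_1) mpoly" where
  "var i = Poly_Mapping.single (Poly_Mapping.single i 1) 1"

definition ideal_power :: "('n, 'k::comm_ring_1) mpoly set \<Rightarrow> nat \<Rightarrow> ('n, 'k) mpoly set" where
  "ideal_power I m = I [^]\<^bsub>ideals_set mpoly_ring\<^esub> m"


definition simplicial_complex :: "'n set set \<Rightarrow> bool" where
  "simplicial_complex \<Delta> \<longleftrightarrow>
     (\<forall>F\<in>\<Delta>. \<forall>G. G \<subseteq> F \<longrightarrow> G \<in> \<Delta>) \<and> (\<forall>i. {i} \<in> \<Delta>)"

definition facets :: "'n set set \<Rightarrow> 'n set set" where
  "facets \<Delta> = {F \<in> \<Delta>. \<forall>G\<in>\<Delta>. F \<subseteq> G \<longrightarrow> G = F}"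

definition face_dim :: "'n set \<Rightarrow> int" where
  "face_dim F = int (card F) - 1"

definition complex_dim :: "'n::finite set set \<Rightarrow> int" where
  "complex_dim \<Delta> = Max (face_dim ` \<Delta>)"

definition pure :: "'n set set \<Rightarrow> bool" where
  "pure \<Delta> \<longleftrightarrow> (\<forall>F\<in>facets \<Delta>. \<forall>G\<in>facets \<Delta>. face_dim F = face_dim G)"


definition stanley_reisner_ideal :: "'n::finite set set \<Rightarrow> ('n, 'k::field) mpoly set" where
  "stanley_reisner_ideal \<Delta> = Idl\<^bsub>mpoly_ring\<^esub> {\<Prod>i\<in>S. var i | S. S \<notin> \<Delta>}"

definition facet_prime :: "'n::finite set \<Rightarrow> ('n, 'k::field) mpoly set" where
  "facet_prime F = Idl\<^bsub>mpoly_ring\<^esub> {var i | i. i \<notin> F}"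

definition symbolic_power :: "'n::finite set set \<Rightarrow> nat \<Rightarrow> ('n, 'k::field) mpoly set" where
  "symbolic_power \<Delta> m = (\<Inter>F\<in>facets \<Delta>. ideal_power (facet_prime F) m)"


definition edges :: "'n set set \<Rightarrow> 'n set set" where
  "edges \<Delta> = {e \<in> \<Delta>. card e = 2}"

definition ramsey_graph :: "nat \<Rightarrow> nat \<Rightarrow> 'n set \<Rightarrow> 'n set set \<Rightarrow> bool" where
  "ramsey_graph s t V E \<longleftrightarrow>
     \<not> (\<exists>S\<subseteq>V. card S = s \<and> clique S E) \<and> \<not> (\<exists>S\<subseteq>V. card S = t \<and> indep S E)"

end

theory Submission
  imports Defs
begin

text \<open>
  A monomial \<open>x\<^sup>a\<close> lies in the symbolic power \<open>I\<^sup>(\<^sup>m\<^sup>)\<close> as soon as \<open>a\<close> has total mass at least \<open>m\<close> off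
  every face. Conversely, if a vertex weight \<open>w\<close> gives every nonface weight at least \<open>c\<close>, then
  every monomial occurring in \<open>I\<^sup>m\<close> has weight at least \<open>m * c\<close>. So a monomial of the first
  kind of weight less than \<open>m * c\<close> separates \<open>I\<^sup>(\<^sup>m\<^sup>)\<close> from \<open>I\<^sup>m\<close>. Write \<open>x\<^sub>A\<close> for the
  product of the variables in \<open>A\<close>; all faces have at most three vertices.

  For an independent set \<open>T\<close> of size 3, every vertex has weight 1, \<open>c = 2\<close>, and the monomial is
  \<open>x\<^sub>T\<^sup>k\<close> for \<open>m = 2 * k\<close>, or \<open>x\<^sub>T\<^sup>k\<close> times two variables of \<open>T\<close> for \<open>m = 2 * k + 1\<close>.

  For a clique \<open>S\<close>, the weight is 1 on \<open>S\<close> and 2 elsewhere, with \<open>c = 3\<close>. If \<open>card S = 5\<close>, the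
  monomial is \<open>x\<^sub>S\<^sup>k\<close> for \<open>m = 2 * k\<close>, or \<open>x\<^sub>S\<^sup>k x\<^sub>W\<close> with \<open>W \<supseteq> S\<close> of size 6 for
  \<open>m = 2 * k + 3\<close>. If \<open>card S = 4\<close> and \<open>S\<close> does not extend to a clique of size 5, then some vertex
  \<open>v\<close> outside is not joined to some \<open>s \<in> S\<close>, and the monomial is \<open>(x\<^sub>s x\<^sub>v)\<^sup>m\<^sup>-\<^sup>3 x\<^sub>W\<close> with
  \<open>W \<supseteq> insert v S\<close> of size 6.
\<close>

section \<open>Ideal powers in the polynomial ring\<close>

lemma mpoly_ring_simps:
  "carrier (mpoly_ring :: ('n, 'k::comm_ring_1) mpoly ring) = UNIV"
  "p \<otimes>\<^bsub>(mpoly_ring :: ('n, 'k) mpoly ring)\<^esub> q = p * q"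
  "p \<oplus>\<^bsub>(mpoly_ring :: ('n, 'k) mpoly ring)\<^esub> q = p + q"
  "\<zero>\<^bsub>(mpoly_ring :: ('n, 'k) mpoly ring)\<^esub> = 0"
  by (simp_all add: ring_of_type_algebra_def)

lemma ideal_power_0: "ideal_power (I :: ('n, 'k::comm_ring_1) mpoly set) 0 = UNIV"
  by (simp add: ideal_power_def ideals_set_def mpoly_ring_simps)

lemma ideal_power_Suc:
  "ideal_power (I :: ('n, 'k::comm_ring_1) mpoly set) (Suc m)
    = ideal_power I m \<cdot>\<^bsub>mpoly_ring\<^esub> I"
  by (simp add: ideal_power_def ideals_set_def)

lemma mult_in_ideal_power_Suc:
  fixes p q :: "('n, 'k::comm_ring_1) mpoly"
  assumes "p \<in> ideal_power I m" "q \<in> I"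
  shows "p * q \<in> ideal_power I (Suc m)"
  using ideal_prod.prod[OF assms, of mpoly_ring] by (simp add: ideal_power_Suc mpoly_ring_simps)

lemma genideal_superset:
  "H \<subseteq> Idl\<^bsub>(mpoly_ring :: ('n, 'k::comm_ring_1) mpoly ring)\<^esub> H"
  by (rule ring.genideal_self[OF ring_from_type_algebra]) (simp add: mpoly_ring_simps)

abbreviation monomial :: "('n \<Rightarrow>\<^sub>0 nat) \<Rightarrow> ('n, 'k::comm_ring_1) mpoly" where
  "monomial t \<equiv> Poly_Mapping.single t 1"

text \<open>Each factor from \<open>facet_prime F\<close> uses up one variable indexed outside
  \<open>F\<close>; the induction on \<open>m\<close> splits off one such variable at a
  time.\<close>

lemma monomial_in_facet_prime_power:
  fixes F :: "'n::finite set"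
  assumes "m \<le> (\<Sum>i\<in>-F. Poly_Mapping.lookup t i)"
  shows "(monomial t :: ('n, 'k::field) mpoly) \<in> ideal_power (facet_prime F) m"
  using assms
proof (induction m arbitrary: t)
  case 0
  then show ?case by (simp add: ideal_power_0)
next
  case (Suc m)
  then obtain i where i: "i \<notin> F" "Poly_Mapping.lookup t i > 0"
    by (metis ComplD Suc_le_D gr0I nat.distinct(1) sum.neutral)
  define s where "s = t - Poly_Mapping.single i 1"
  have t: "t = s + Poly_Mapping.single i 1"
    using i by (intro poly_mapping_eqI) (auto simp: s_def lookup_add lookup_minus lookup_single when_def)
  have "(\<Sum>j\<in>-F. Poly_Mapping.lookup t j) = (\<Sum>j\<in>-F. Poly_Mapping.lookup s j) + 1"
    using i by (simp add: t lookup_add sum.distrib lookup_single when_def)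
  then have "m \<le> (\<Sum>j\<in>-F. Poly_Mapping.lookup s j)"
    using Suc.prems by simp
  then have "(monomial s :: ('n, 'k) mpoly) \<in> ideal_power (facet_prime F) m"
    by (rule Suc.IH)
  moreover have "(var i :: ('n, 'k) mpoly) \<in> facet_prime F"
    unfolding facet_prime_def using i(1) by (intro subsetD[OF genideal_superset] CollectI) blast
  ultimately have "(monomial s :: ('n, 'k) mpoly) * var i \<in> ideal_power (facet_prime F) (Suc m)"
    by (rule mult_in_ideal_power_Suc)
  then show ?case
    by (simp add: var_def mult_single t)
qed

section \<open>Weights of monomials\<close>

definition weight :: "('n::finite \<Rightarrow> nat) \<Rightarrow> ('n \<Rightarrow>\<^sub>0 nat) \<Rightarrow> nat" where
  "weight w t = (\<Sum>i\<in>UNIV. Poly_Mapping.lookup t i * w i)"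

lemma weight_add: "weight w (s + t) = weight w s + weight w t"
  by (simp add: weight_def lookup_add sum.distrib distrib_right)

lemma weight_zero [simp]: "weight w 0 = 0"
  by (simp add: weight_def)

lemma weight_sum: "finite A \<Longrightarrow> weight w (\<Sum>x\<in>A. f x) = (\<Sum>x\<in>A. weight w (f x))"
  by (induction A rule: finite_induct) (auto simp: weight_add)

lemma weight_single [simp]: "weight w (Poly_Mapping.single i k) = k * w i"
  by (simp add: weight_def lookup_single when_def if_distrib[of "\<lambda>x. x * _"] cong: if_cong)

text \<open>The order filtration of the grading given by \<open>w\<close>; the zero polynomial has
  no keys and so lies in every step.\<close>

definition weight_ideal :: "('n::finite \<Rightarrow> nat) \<Rightarrow> nat \<Rightarrow> ('n, 'k::comm_ring_1) mpoly set" where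
  "weight_ideal w d = {p. \<forall>t\<in>Poly_Mapping.keys p. d \<le> weight w t}"

lemma weight_ideal_mult:
  assumes "p \<in> weight_ideal w d" "q \<in> weight_ideal w e"
  shows "p * q \<in> weight_ideal w (d + e)"
proof -
  have "d + e \<le> weight w t" if t: "t \<in> Poly_Mapping.keys (p * q)" for t
  proof -
    obtain t1 t2 where "t = t1 + t2" "t1 \<in> Poly_Mapping.keys p" "t2 \<in> Poly_Mapping.keys q"
      using t keys_mult[of p q] by blast
    then show ?thesis
      using assms by (simp add: weight_ideal_def weight_add add_mono)
  qed
  then show ?thesis
    by (simp add: weight_ideal_def)
qed

lemma weight_ideal_add:
  assumes "p \<in> weight_ideal w d" "q \<in> weight_ideal w d"
  shows "p + q \<in> weight_ideal w d"
  using assms keys_add[of p q] by (auto simp: weight_ideal_def)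

lemma weight_ideal_0 [simp]: "weight_ideal w 0 = UNIV"
  by (simp add: weight_ideal_def)

lemma ideal_weight_ideal:
  "ideal (weight_ideal w d :: ('n::finite, 'k::comm_ring_1) mpoly set) mpoly_ring"
proof (rule idealI)
  show "ring (mpoly_ring :: ('n, 'k) mpoly ring)" ..
  then interpret ring "mpoly_ring :: ('n, 'k) mpoly ring" .
  have minus: "\<ominus>\<^bsub>mpoly_ring\<^esub> p = - p" for p :: "('n, 'k) mpoly"
    by (rule minus_equality) (simp_all add: mpoly_ring_simps)
  have uminus: "- p \<in> weight_ideal w d" if "p \<in> weight_ideal w d" for p :: "('n, 'k) mpoly"
    using that by (simp add: weight_ideal_def)
  show "subgroup (weight_ideal w d) (add_monoid (mpoly_ring :: ('n, 'k) mpoly ring))"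
  proof
    show "inv\<^bsub>add_monoid mpoly_ring\<^esub> p \<in> weight_ideal w d" if "p \<in> weight_ideal w d"
      for p :: "('n, 'k) mpoly"
      using uminus[OF that] minus[of p] by (simp add: a_inv_def)
    show "\<one>\<^bsub>add_monoid mpoly_ring\<^esub> \<in> (weight_ideal w d :: ('n, 'k) mpoly set)"
      by (simp add: mpoly_ring_simps weight_ideal_def)
  qed (simp_all add: mpoly_ring_simps weight_ideal_add)
next
  fix p q :: "('n, 'k) mpoly"
  assume "p \<in> weight_ideal w d"
  then show "q \<otimes>\<^bsub>mpoly_ring\<^esub> p \<in> weight_ideal w d" "p \<otimes>\<^bsub>mpoly_ring\<^esub> q \<in> weight_ideal w d"
    using weight_ideal_mult[of q w 0 p d] weight_ideal_mult[of p w d q 0]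
    by (simp_all add: mpoly_ring_simps)
qed

lemma prod_var: "(\<Prod>i\<in>S. var i) = monomial (\<Sum>i\<in>S. Poly_Mapping.single i 1)"
  by (induction S rule: infinite_finite_induct) (auto simp: var_def mult_single)

lemma stanley_reisner_ideal_subset_weight_ideal:
  assumes "\<And>S. S \<notin> \<Delta> \<Longrightarrow> c \<le> sum w S"
  shows "(stanley_reisner_ideal \<Delta> :: ('n::finite, 'k::field) mpoly set) \<subseteq> weight_ideal w c"
  unfolding stanley_reisner_ideal_def
proof (rule ring.genideal_minimal[OF ring_from_type_algebra ideal_weight_ideal])
  show "{\<Prod>i\<in>S. var i :: ('n, 'k) mpoly | S. S \<notin> \<Delta>} \<subseteq> weight_ideal w c"
    using assms by (auto simp: prod_var weight_ideal_def weight_sum)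
qed

lemma ideal_power_subset_weight_ideal:
  assumes "(I :: ('n::finite, 'k::field) mpoly set) \<subseteq> weight_ideal w c"
  shows "ideal_power I m \<subseteq> weight_ideal w (m * c)"
proof (induction m)
  case 0
  then show ?case by simp
next
  case (Suc m)
  \<comment> \<open>A product ideal is built from products by addition, and the weight bound
    survives both.\<close>
  have "p \<in> weight_ideal w (m * c + c)" if "p \<in> ideal_power I m \<cdot>\<^bsub>mpoly_ring\<^esub> I" for p
    using that
  proof induction
    case (prod p q)
    then show ?case
      using weight_ideal_mult[of p w "m * c" q c] Suc assms by (auto simp: mpoly_ring_simps)
  next
    case (sum p q)
    then show ?case by (simp add: mpoly_ring_simps weight_ideal_add)
  qed
  then show ?case by (auto simp: ideal_power_Suc add.commute)
qed

text \<open>The separating monomial is \<open>x_A^k x_B\<close>, with exponent vector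
  \<open>t\<close>; this shape covers every case below.\<close>

lemma symbolic_power_neq_ideal_power:
  fixes \<Delta> :: "'n::finite set set" and w :: "'n \<Rightarrow> nat"
  assumes faces: "\<And>F. F \<in> \<Delta> \<Longrightarrow> m \<le> k * card (A - F) + card (B - F)"
    and nonfaces: "\<And>G. G \<notin> \<Delta> \<Longrightarrow> c \<le> sum w G"
    and less: "k * sum w A + sum w B < m * c"
  shows "(symbolic_power \<Delta> m :: ('n, 'k::field) mpoly set) \<noteq> ideal_power (stanley_reisner_ideal \<Delta>) m"
proof -
  define t where "t = Abs_poly_mapping (\<lambda>i::'n. k * of_bool (i \<in> A) + of_bool (i \<in> B) :: nat)"
  have t: "Poly_Mapping.lookup t i = k * of_bool (i \<in> A) + of_bool (i \<in> B)" for i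
    by (simp add: t_def)
  \<comment> \<open>The \<open>of_bool\<close> sums over \<open>-F\<close> count this
    intersection.\<close>
  have "-F \<inter> {i. i \<in> C} = C - F" for C F :: "'n set"
    by blast
  then have "(\<Sum>i\<in>-F. Poly_Mapping.lookup t i) = k * card (A - F) + card (B - F)" for F
    by (simp add: t sum.distrib del: Collect_mem_eq flip: sum_distrib_left)
  then have "(monomial t :: ('n, 'k) mpoly) \<in> symbolic_power \<Delta> m"
    using faces by (auto simp: symbolic_power_def facets_def intro!: monomial_in_facet_prime_power)
  moreover have "weight w t = k * sum w A + sum w B"
  proof -
    have "(\<Sum>i\<in>UNIV. of_bool (i \<in> A) * w i) = sum w A" for A
      by (simp add: of_bool_def if_distrib[of "\<lambda>x. x * _"] sum.If_cases cong: if_cong)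
    then show ?thesis
      by (simp add: weight_def t distrib_right sum.distrib mult.assoc flip: sum_distrib_left)
  qed
  then have "(monomial t :: ('n, 'k) mpoly) \<notin> weight_ideal w (m * c)"
    using less by (simp add: weight_ideal_def)
  ultimately show ?thesis
    using ideal_power_subset_weight_ideal[OF stanley_reisner_ideal_subset_weight_ideal]
      nonfaces by blast
qed

section \<open>Cliques and independent sets in the graph of a complex\<close>

lemma simplicial_complex_subset:
  "simplicial_complex \<Delta> \<Longrightarrow> F \<in> \<Delta> \<Longrightarrow> G \<subseteq> F \<Longrightarrow> G \<in> \<Delta>"
  by (auto simp: simplicial_complex_def)

lemma two_le_card_nonface:
  fixes G :: "'n::finite set"
  assumes "simplicial_complex \<Delta>" "G \<notin> \<Delta>"
  shows "2 \<le> card G"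
proof -
  have single: "{i} \<in> \<Delta>" for i
    using assms by (simp add: simplicial_complex_def)
  then have "{} \<in> \<Delta>"
    using simplicial_complex_subset[OF assms(1)] by blast
  with single have "card G \<noteq> 0" "card G \<noteq> 1"
    using assms(2) by (auto simp: card_1_singleton_iff)
  then show ?thesis by linarith
qed

definition clique_weight :: "'n set \<Rightarrow> 'n \<Rightarrow> nat" where
  "clique_weight S i = 1 + of_bool (i \<notin> S)"

lemma sum_clique_weight:
  "sum (clique_weight S) (A :: 'n::finite set) = card A + card (A - S)"
proof -
  have "A \<inter> {i. i \<notin> S} = A - S" by blast
  then show ?thesis
    unfolding clique_weight_def sum.distrib by simp
qed

text \<open>All pairs inside \<open>S\<close> are edges, so a nonface of size 2 has a vertex outside
  \<open>S\<close>, of weight 2; larger nonfaces reach 3 by size alone.\<close>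

lemma three_le_clique_weight_nonface:
  fixes G :: "'n::finite set"
  assumes "simplicial_complex \<Delta>" "clique S (edges \<Delta>)" "G \<notin> \<Delta>"
  shows "3 \<le> sum (clique_weight S) G"
proof (cases "card G = 2 \<and> G \<subseteq> S")
  case True
  then obtain x y where "G = {x, y}" "x \<noteq> y"
    by (auto simp: card_2_iff)
  with True assms(2,3) show ?thesis
    by (auto simp: clique_def edges_def)
next
  case False
  then have "card G \<noteq> 2 \<or> 0 < card (G - S)"
    by (auto simp: card_gt_0_iff)
  then show ?thesis
    using two_le_card_nonface[OF assms(1,3)] unfolding sum_clique_weight by linarith
qed

lemma card_face_le_3:
  fixes F :: "'n::finite set"
  assumes "complex_dim \<Delta> = 2" "F \<in> \<Delta>"
  shows "card F \<le> 3"
proof -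
  have "face_dim F \<le> complex_dim \<Delta>"
    unfolding complex_dim_def using assms by (intro Max_ge) auto
  then show ?thesis
    using assms by (simp add: face_dim_def)
qed

lemma card_Diff_face:
  fixes F :: "'n::finite set"
  assumes "complex_dim \<Delta> = 2" "F \<in> \<Delta>"
  shows "card A - 3 \<le> card (A - F)"
  using card_face_le_3[OF assms] diff_card_le_card_Diff[of F A] by simp

section \<open>Excluding independent triples and large cliques\<close>

lemma no_indep_3:
  fixes \<Delta> :: "'n::finite set set"
  assumes \<Delta>: "simplicial_complex \<Delta>"
    and eq: "(symbolic_power \<Delta> m :: ('n, 'k::field) mpoly set) = ideal_power (stanley_reisner_ideal \<Delta>) m"
    and m: "2 \<le> m"
    and T: "card T = 3" "indep T (edges \<Delta>)"
  shows False
proof -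
  \<comment> \<open>Two common vertices would span an edge inside \<open>F\<close>, against
    independence.\<close>
  have le1: "card (T \<inter> F) \<le> 1" if "F \<in> \<Delta>" for F
  proof (rule ccontr)
    assume "\<not> ?thesis"
    then obtain x y where xy: "x \<in> T \<inter> F" "y \<in> T \<inter> F" "x \<noteq> y"
      by (metis card_le_Suc0_iff_eq finite One_nat_def)
    then have "{x, y} \<in> edges \<Delta>"
      using simplicial_complex_subset[OF \<Delta> that, of "{x, y}"] by (auto simp: edges_def)
    with T(2) xy show False
      by (auto simp: indep_def)
  qed
  have off: "card A - 1 \<le> card (A - F)" if "F \<in> \<Delta>" "A \<subseteq> T" for A F
  proof -
    have "card (A \<inter> F) \<le> card (T \<inter> F)"
      using that by (intro card_mono) auto
    then show ?thesis
      using le1[OF that(1)] by (simp add: card_Diff_subset_Int)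
  qed
  have nonface: "2 \<le> sum (\<lambda>_. 1 :: nat) G" if "G \<notin> \<Delta>" for G
    using two_le_card_nonface[OF \<Delta> that] by simp
  show False
  proof (cases "even m")
    case True
    then obtain k where k: "m = 2 * k" ..
    have "m \<le> k * card (T - F) + card ({} - F)" if "F \<in> \<Delta>" for F
      using mult_le_mono2[of 2 "card (T - F)" k] off[OF that order_refl] T(1) k by simp
    from symbolic_power_neq_ideal_power[OF this nonface, where 'k='k] show False
      using eq T(1) k m by simp
  next
    case False
    then obtain k where k: "m = 2 * k + 1" by (rule oddE)
    \<comment> \<open>A face misses a vertex of \<open>P\<close>, the one unit that odd
      \<open>m\<close> still needs. The degree \<open>3 * k + 2\<close> is below
      \<open>2 * m = 4 * k + 2\<close> because \<open>m \<ge> 2\<close> forces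
      \<open>k \<ge> 1\<close>.\<close>
    obtain P where P: "P \<subseteq> T" "card P = 2"
      using obtain_subset_with_card_n[of 2 T] T(1) by auto
    have "m \<le> k * card (T - F) + card (P - F)" if "F \<in> \<Delta>" for F
    proof -
      have "2 \<le> card (T - F)" "1 \<le> card (P - F)"
        using off[OF that order_refl] off[OF that P(1)] T(1) P(2) by simp_all
      then show ?thesis
        using mult_le_mono2[of 2 "card (T - F)" k] k by linarith
    qed
    from symbolic_power_neq_ideal_power[OF this nonface, where 'k='k] show False
      using eq T(1) P(2) k m by simp
  qed
qed

text \<open>A face misses at least two vertices of \<open>S\<close>, which settles even
  \<open>m\<close>. For odd \<open>m\<close> a sixth vertex is added once, so that every face misses
  three of the six.\<close>

lemma no_clique_5:
  fixes \<Delta> :: "'n::finite set set"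
  assumes \<Delta>: "simplicial_complex \<Delta>" "complex_dim \<Delta> = 2"
    and eq: "(symbolic_power \<Delta> m :: ('n, 'k::field) mpoly set) = ideal_power (stanley_reisner_ideal \<Delta>) m"
    and m: "2 \<le> m" "even m \<or> 6 \<le> CARD('n)"
    and S: "card S = 5" "clique S (edges \<Delta>)"
  shows False
proof -
  note nonface = three_le_clique_weight_nonface[OF \<Delta>(1) S(2)]
  have off: "k * 2 \<le> k * card (S - F)" if "F \<in> \<Delta>" for F k
    using card_Diff_face[OF \<Delta>(2) that, of S] S(1) by simp
  show False
  proof (cases "even m")
    case True
    then obtain k where k: "m = 2 * k" ..
    have "m \<le> k * card (S - F) + card ({} - F)" if "F \<in> \<Delta>" for F
      using off[OF that] k by (simp add: mult.commute)
    from symbolic_power_neq_ideal_power[OF this nonface, where 'k='k] show False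
      using eq S(1) k m by (simp add: sum_clique_weight)
  next
    case False
    then obtain j where "m = 2 * j + 1" by (rule oddE)
    \<comment> \<open>As \<open>m\<close> is odd and at least 2, \<open>j \<ge> 1\<close> and the
      subtraction is exact.\<close>
    with m(1) have k: "m = 2 * (j - 1) + 3" by simp
    have "S \<noteq> UNIV"
      using m(2) False S(1) by auto
    then obtain v where v: "v \<notin> S"
      by blast
    have "m \<le> (j - 1) * card (S - F) + card (insert v S - F)" if "F \<in> \<Delta>" for F
    proof -
      have "3 \<le> card (insert v S - F)"
        using card_Diff_face[OF \<Delta>(2) that, of "insert v S"] v S(1) by simp
      then show ?thesis
        using off[OF that, of "j - 1"] k by linarith
    qed
    from symbolic_power_neq_ideal_power[OF this nonface, where 'k='k] show False
      using eq S(1) k v by (simp add: sum_clique_weight insert_Diff_if)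
  qed
qed

lemma no_clique_4:
  fixes \<Delta> :: "'n::finite set set"
  assumes \<Delta>: "simplicial_complex \<Delta>" "complex_dim \<Delta> = 2"
    and eq: "(symbolic_power \<Delta> m :: ('n, 'k::field) mpoly set) = ideal_power (stanley_reisner_ideal \<Delta>) m"
    and m: "3 \<le> m" "6 \<le> CARD('n)"
    and S: "card S = 4" "clique S (edges \<Delta>)"
  shows False
proof -
  have "S \<noteq> UNIV"
    using m(2) S(1) by auto
  then obtain v where v: "v \<notin> S"
    by blast
  \<comment> \<open>A clique of size 5 is already excluded, so \<open>v\<close> has a non-neighbour
    \<open>s\<close> in \<open>S\<close>.\<close>
  have "\<not> clique (insert v S) (edges \<Delta>)"
    using no_clique_5[OF \<Delta> eq, of "insert v S"] m v S(1) by auto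
  then obtain s where s: "s \<in> S" "{s, v} \<notin> \<Delta>"
    using S(2) v by (auto simp: clique_def edges_def insert_commute card_insert_if)
  have "card (insert v S) < CARD('n)"
    using m(2) v S(1) by simp
  then have "insert v S \<noteq> UNIV"
    by auto
  then obtain u where u: "u \<notin> insert v S"
    by blast
  let ?W = "insert u (insert v S)"
  have W: "card ?W = 6" "?W - S = {u, v}" "u \<noteq> v"
    using u v S(1) by auto
  have faces: "m \<le> (m - 3) * card ({s, v} - F) + card (?W - F)" if "F \<in> \<Delta>" for F
  proof -
    \<comment> \<open>No face contains the nonedge, so each factor \<open>x_s x_v\<close>
      contributes at least one off \<open>F\<close>.\<close>
    have "\<not> {s, v} \<subseteq> F"
      using simplicial_complex_subset[OF \<Delta>(1) that] s(2) by blast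
    then have "{s, v} - F \<noteq> {}" by blast
    then have "1 \<le> card ({s, v} - F)"
      by (simp add: Suc_le_eq card_gt_0_iff)
    then have "(m - 3) * 1 \<le> (m - 3) * card ({s, v} - F)"
      by (rule mult_le_mono2)
    moreover have "3 \<le> card (?W - F)"
      using card_Diff_face[OF \<Delta>(2) that, of ?W] W(1) by simp
    ultimately show ?thesis
      by linarith
  qed
  \<comment> \<open>The pair has weight 3 and \<open>?W\<close> has weight 8, so the total is
    \<open>3 * m - 1\<close>.\<close>
  have "{s, v} - S = {v}" "s \<noteq> v"
    using s v by auto
  then have less: "(m - 3) * sum (clique_weight S) {s, v} + sum (clique_weight S) ?W < m * 3"
    unfolding sum_clique_weight using W m(1) by simp
  show False
    using symbolic_power_neq_ideal_power[OF faces
        three_le_clique_weight_nonface[OF \<Delta>(1) S(2)] less, where 'k='k] eq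
    by contradiction
qed

theorem corollary1p7:
  fixes \<Delta> :: "'n::finite set set"
  assumes "simplicial_complex \<Delta>"
    and "pure \<Delta>"
    and "complex_dim \<Delta> = 2"
  shows "((symbolic_power \<Delta> 2 :: ('n, 'k::field) mpoly set)
            = ideal_power (stanley_reisner_ideal \<Delta>) 2
          \<longrightarrow> ramsey_graph 5 3 UNIV (edges \<Delta>)) \<and>
         ((\<exists>m\<ge>3. (symbolic_power \<Delta> m :: ('n, 'k) mpoly set)
            = ideal_power (stanley_reisner_ideal \<Delta>) m) \<and> CARD('n) \<ge> 6
          \<longrightarrow> ramsey_graph 4 3 UNIV (edges \<Delta>))"
proof (intro conjI impI)
  assume "(symbolic_power \<Delta> 2 :: ('n, 'k) mpoly set) = ideal_power (stanley_reisner_ideal \<Delta>) 2"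
  \<comment> \<open>Since 2 is even, \<open>no_clique_5\<close> applies without a sixth
    vertex.\<close>
  then show "ramsey_graph 5 3 UNIV (edges \<Delta>)"
    using no_clique_5[OF assms(1,3)] no_indep_3[OF assms(1)] unfolding ramsey_graph_def
    by (metis order_refl even_numeral)
next
  assume "(\<exists>m\<ge>3. (symbolic_power \<Delta> m :: ('n, 'k) mpoly set)
    = ideal_power (stanley_reisner_ideal \<Delta>) m) \<and> CARD('n) \<ge> 6"
  then obtain m where m: "3 \<le> m" "6 \<le> CARD('n)"
      "(symbolic_power \<Delta> m :: ('n, 'k) mpoly set) = ideal_power (stanley_reisner_ideal \<Delta>) m"
    by blast
  moreover have "2 \<le> m" using m(1) by simp
  ultimately show "ramsey_graph 4 3 UNIV (edges \<Delta>)"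
    using no_clique_4[OF assms(1,3)] no_indep_3[OF assms(1)] unfolding ramsey_graph_def
    by metis
qed

end
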